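(* Let $k$ be an algebraically closed field, $Q$ a finite connected acyclic quiver, $\mathbf{1}=(1,\dots,1)\in\mathbb{Z}^{Q_0}$, $\theta$ a stability condition, and let $M\in R(Q,\mathbf{1})^{\theta-\mathrm{st}}$. 1. The isomorphism class $[M]$ is a fixed point of the $T_0$-action on $M^{\theta-\mathrm{st}}(Q,\mathbf{1})$ if and only if $H:=\mathrm{supp}(M)$ is a $\theta$-stable spanning tree. In this case $M$ and $M_H$ are isomorphic. 2. Let $H$ be a spanning tree of $Q$. Then the composition $T_{H^c}\to T\to T_0$ is an isomorphism.
   Context: $R(Q,\mathbf{1})=k^{Q_1}$ is the space of representations $M=(M_\alpha)_{\alpha\in Q_1}$ of $Q$ of dimension vector $\mathbf{1}$. The torus $G_{\mathbf{1}}=\mathbb{G}_m^{Q_0}$ acts by $g\cdot M=(g_{t(\alpha)}g_{s(\alpha)}^{-1}M_\alpha)_\alpha$ ($s,t$ = source, target); the diagonal $\Delta\cong\mathbb{G}_m$ acts trivially and $PG_{\mathbf{1}}=G_{\mathbf{1}}/\Delta$. $T=\mathbb{G}_m^{Q_1}$ acts by $t.M=(t_\alpha M_\alpha)_\alpha$. The map $\sigma_Q:G_{\mathbf{1}}\to T$, $g\mapsto(g_{t(\alpha)}g_{s(\alpha)}^{-1})_\alpha$ has kernel $\Delta$; $T_0:=T/\sigma_Q(G_{\mathbf{1}})$. A stability condition is a $\mathbb{Z}$-linear map $\theta:\mathbb{Z}^{Q_0}\to\mathbb{Z}$; the slope is $\mu(e)=\theta(e)/\sum_ie_i$ for a non-zero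 dimension vector $e$; $M$ is $\theta$-stable if $\mu(\underline{\dim}M')<\mu(\underline{\dim}M)$ for all non-zero proper subrepresentations $M'$. $R(Q,\mathbf{1})^{\theta-\mathrm{st}}$ is the open stable locus, $M^{\theta-\mathrm{st}}(Q,\mathbf{1})=R(Q,\mathbf{1})^{\theta-\mathrm{st}}/PG_{\mathbf{1}}$ the geometric quotient, whose points are isomorphism classes $[M]$; the $T$-action descends to it and factors through $T_0$. $\mathrm{supp}(M)=\{\alpha\in Q_1\mid M_\alpha\ne0\}$. For $H\subseteq Q_1$, $M_H\in R(Q,\mathbf{1})$ is given by $(M_H)_\alpha=1$ if $\alpha\in H$ and $0$ otherwise; $H^c=Q_1\setminus H$. $H$ is a spanning tree if the underlying unoriented (multi)graph of $(Q_0,H)$ is connected and cycle-free; a spanning tree $H$ is $\theta$-stable if $M_H$ is $\theta$-stable. $T_{H^c}=\{t\in T\mid t_\alpha=1\text{ for all }\alpha\in H\}$. *)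

theory Defs
  imports
    "HOL-Algebra.Product_Groups"
    "HOL-Algebra.Group_Action"
    "HOL-Computational_Algebra.Polynomial"
    "Graph_Theory.Graph_Theory"
begin

section \<open>Quivers\<close>

text \<open>
  A quiver is a multi-digraph in the sense of \<^typ>\<open>('v, 'a) pre_digraph\<close>, with loops and
  parallel arrows allowed; the source and target of an arrow are given by \<^const>\<open>tail\<close> and
  \<^const>\<open>head\<close>.
\<close>

definition acyclic_quiver :: "('v, 'a) pre_digraph \<Rightarrow> bool" where
  "acyclic_quiver Q \<longleftrightarrow> \<not> (\<exists>p. pre_digraph.cycle Q p)"

text \<open>
  The library predicates \<^const>\<open>forest\<close> and \<^const>\<open>spanning_tree\<close> exclude directed cycles only.
  For cycles of the underlying unoriented multigraph we therefore walk in the digraph in which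
  every arrow \<open>\<alpha>\<close> may be traversed forwards, as \<open>(\<alpha>, True)\<close>, or backwards, as \<open>(\<alpha>, False)\<close>.
\<close>

definition doubled :: "('v, 'a) pre_digraph \<Rightarrow> ('v, 'a \<times> bool) pre_digraph" where
  "doubled Q = \<lparr> verts = verts Q, arcs = arcs Q \<times> UNIV,
     tail = (\<lambda>(\<alpha>, forward). if forward then tail Q \<alpha> else head Q \<alpha>),
     head = (\<lambda>(\<alpha>, forward). if forward then head Q \<alpha> else tail Q \<alpha>) \<rparr>"

text \<open>
  No edge may be used twice, so that traversing an edge back and forth is not a cycle, whereas
  loops and pairs of parallel edges are.
\<close>

definition unoriented_cycle :: "('v, 'a) pre_digraph \<Rightarrow> ('a \<times> bool) list \<Rightarrow> bool" where
  "unoriented_cycle Q p \<longleftrightarrow> pre_digraph.cycle (doubled Q) p \<and> distinct (map fst p)"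

definition quiver_spanning_tree :: "('v, 'a) pre_digraph \<Rightarrow> 'a set \<Rightarrow> bool" where
  "quiver_spanning_tree Q H \<longleftrightarrow> H \<subseteq> arcs Q \<and>
     Digraph_Component.connected (Q\<lparr>arcs := H\<rparr>) \<and>
     \<not> (\<exists>p. unoriented_cycle (Q\<lparr>arcs := H\<rparr>) p)"


section \<open>Tori\<close>

definition Gm :: "'k::field monoid" where
  "Gm = \<lparr> carrier = UNIV - {0}, monoid.mult = (*), one = 1 \<rparr>"

definition torus :: "'i set \<Rightarrow> ('i \<Rightarrow> 'k::field) monoid" where
  "torus I = product_group I (\<lambda>_. Gm)"

definition sigma :: "('v, 'a) pre_digraph \<Rightarrow> ('v \<Rightarrow> 'k::field) \<Rightarrow> ('a \<Rightarrow> 'k)" where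
  "sigma Q g = (\<lambda>\<alpha>\<in>arcs Q. g (head Q \<alpha>) * inverse (g (tail Q \<alpha>)))"

definition diag :: "('v, 'a) pre_digraph \<Rightarrow> ('v \<Rightarrow> 'k::field) set" where
  "diag Q = (\<lambda>c. \<lambda>i\<in>verts Q. c) ` carrier Gm"

definition PG :: "('v, 'a) pre_digraph \<Rightarrow> ('v \<Rightarrow> 'k::field) set monoid" where
  "PG Q = torus (verts Q) Mod diag Q"

definition sigma_image :: "('v, 'a) pre_digraph \<Rightarrow> ('a \<Rightarrow> 'k::field) set" where
  "sigma_image Q = sigma Q ` carrier (torus (verts Q))"

definition T0 :: "('v, 'a) pre_digraph \<Rightarrow> ('a \<Rightarrow> 'k::field) set monoid" where
  "T0 Q = torus (arcs Q) Mod sigma_image Q"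

text \<open>\<open>subtorus Q H\<close> is the group \<open>T_H = {t. t\<^sub>\<alpha> = 1 for \<alpha> \<notin> H}\<close>; it is used with \<open>arcs Q - H\<close>.\<close>

definition subtorus :: "('v, 'a) pre_digraph \<Rightarrow> 'a set \<Rightarrow> ('a \<Rightarrow> 'k::field) set" where
  "subtorus Q H = {t \<in> carrier (torus (arcs Q)). \<forall>\<alpha>\<in>arcs Q - H. t \<alpha> = 1}"


section \<open>Affine algebraic groups\<close>

text \<open>
  An affine algebraic group over an algebraically closed field is given by its group of points
  together with its algebra of regular functions. Functions on a group are taken to be
  extensional, i.e. \<^const>\<open>undefined\<close> off the carrier. On a torus the regular functions are
  the Laurent polynomials in the coordinates.
\<close>

inductive_set torus_functions :: "'i set \<Rightarrow> (('i \<Rightarrow> 'k::field) \<Rightarrow> 'k) set" for I :: "'i set" where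
  const: "(\<lambda>t\<in>carrier (torus I). c) \<in> torus_functions I"
| coord: "i \<in> I \<Longrightarrow> (\<lambda>t\<in>carrier (torus I). t i) \<in> torus_functions I"
| coord_inverse: "i \<in> I \<Longrightarrow> (\<lambda>t\<in>carrier (torus I). inverse (t i)) \<in> torus_functions I"
| add: "f \<in> torus_functions I \<Longrightarrow> h \<in> torus_functions I \<Longrightarrow>
    (\<lambda>t\<in>carrier (torus I). f t + h t) \<in> torus_functions I"
| mult: "f \<in> torus_functions I \<Longrightarrow> h \<in> torus_functions I \<Longrightarrow>
    (\<lambda>t\<in>carrier (torus I). f t * h t) \<in> torus_functions I"

text \<open>
  A closed subgroup \<open>S\<close> carries the restrictions of regular functions; a quotient
  by a normal subgroup \<open>N\<close> carries those functions whose pullback along the projection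
  is regular, that is, the \<open>N\<close>-invariant regular functions.
\<close>

definition subgroup_functions :: "'g set \<Rightarrow> ('g \<Rightarrow> 'k) set \<Rightarrow> ('g \<Rightarrow> 'k) set" where
  "subgroup_functions S A = (\<lambda>f. restrict f S) ` A"

definition quotient_functions ::
    "('g, 'm) monoid_scheme \<Rightarrow> 'g set \<Rightarrow> ('g \<Rightarrow> 'k) set \<Rightarrow> ('g set \<Rightarrow> 'k) set" where
  "quotient_functions G N A =
     {f \<in> extensional (carrier (G Mod N)). (\<lambda>x\<in>carrier G. f (N #>\<^bsub>G\<^esub> x)) \<in> A}"

definition alg_group_hom ::
    "('g, 'm) monoid_scheme \<Rightarrow> ('g \<Rightarrow> 'k) set \<Rightarrow> ('h, 'n) monoid_scheme \<Rightarrow> ('h \<Rightarrow> 'k) set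
      \<Rightarrow> ('g \<Rightarrow> 'h) set" where
  "alg_group_hom G A H B =
     {\<phi> \<in> hom G H. \<forall>f\<in>B. (\<lambda>x\<in>carrier G. f (\<phi> x)) \<in> A}"

definition alg_group_iso ::
    "('g, 'm) monoid_scheme \<Rightarrow> ('g \<Rightarrow> 'k) set \<Rightarrow> ('h, 'n) monoid_scheme \<Rightarrow> ('h \<Rightarrow> 'k) set
      \<Rightarrow> ('g \<Rightarrow> 'h) set" where
  "alg_group_iso G A H B =
     {\<phi> \<in> alg_group_hom G A H B. bij_betw \<phi> (carrier G) (carrier H) \<and>
        inv_into (carrier G) \<phi> \<in> alg_group_hom H B G A}"

definition T0_functions :: "('v, 'a) pre_digraph \<Rightarrow> (('a \<Rightarrow> 'k::field) set \<Rightarrow> 'k) set" where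
  "T0_functions Q = quotient_functions (torus (arcs Q)) (sigma_image Q) (torus_functions (arcs Q))"

definition T0_proj :: "('v, 'a) pre_digraph \<Rightarrow> ('a \<Rightarrow> 'k::field) \<Rightarrow> ('a \<Rightarrow> 'k) set" where
  "T0_proj Q t = sigma_image Q #>\<^bsub>torus (arcs Q)\<^esub> t"


section \<open>Representations of dimension vector \<open>\<one>\<close>\<close>

definition rep_space :: "('v, 'a) pre_digraph \<Rightarrow> ('a \<Rightarrow> 'k::field) set" where
  "rep_space Q = (arcs Q \<rightarrow>\<^sub>E UNIV)"

definition base_act ::
    "('v, 'a) pre_digraph \<Rightarrow> ('v \<Rightarrow> 'k::field) \<Rightarrow> ('a \<Rightarrow> 'k) \<Rightarrow> ('a \<Rightarrow> 'k)" where
  "base_act Q g M = (\<lambda>\<alpha>\<in>arcs Q. g (head Q \<alpha>) * inverse (g (tail Q \<alpha>)) * M \<alpha>)"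

definition arrow_act ::
    "('v, 'a) pre_digraph \<Rightarrow> ('a \<Rightarrow> 'k::field) \<Rightarrow> ('a \<Rightarrow> 'k) \<Rightarrow> ('a \<Rightarrow> 'k)" where
  "arrow_act Q t M = (\<lambda>\<alpha>\<in>arcs Q. t \<alpha> * M \<alpha>)"

definition rep_iso :: "('v, 'a) pre_digraph \<Rightarrow> ('a \<Rightarrow> 'k::field) \<Rightarrow> ('a \<Rightarrow> 'k) \<Rightarrow> bool" where
  "rep_iso Q M N \<longleftrightarrow>
     (\<exists>f. (\<forall>i\<in>verts Q. f i \<noteq> 0) \<and>
          (\<forall>\<alpha>\<in>arcs Q. f (head Q \<alpha>) * M \<alpha> = N \<alpha> * f (tail Q \<alpha>)))"

definition supp :: "('v, 'a) pre_digraph \<Rightarrow> ('a \<Rightarrow> 'k::field) \<Rightarrow> 'a set" where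
  "supp Q M = {\<alpha> \<in> arcs Q. M \<alpha> \<noteq> 0}"

definition indicator_rep :: "('v, 'a) pre_digraph \<Rightarrow> 'a set \<Rightarrow> ('a \<Rightarrow> 'k::field)" where
  "indicator_rep Q H = (\<lambda>\<alpha>\<in>arcs Q. if \<alpha> \<in> H then 1 else 0)"


section \<open>Stability\<close>

text \<open>
  A subrepresentation consists of a linear subspace of \<open>k\<close> at every vertex.
\<close>

definition subrep :: "('v, 'a) pre_digraph \<Rightarrow> ('a \<Rightarrow> 'k::field) \<Rightarrow> ('v \<Rightarrow> 'k set) \<Rightarrow> bool" where
  "subrep Q M U \<longleftrightarrow>
     (\<forall>i\<in>verts Q. module.subspace (*) (U i)) \<and>
     (\<forall>\<alpha>\<in>arcs Q. \<forall>x\<in>U (tail Q \<alpha>). M \<alpha> * x \<in> U (head Q \<alpha>))"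

definition dim_vector :: "('v, 'a) pre_digraph \<Rightarrow> ('v \<Rightarrow> 'k::field set) \<Rightarrow> ('v \<Rightarrow> int)" where
  "dim_vector Q U = (\<lambda>i\<in>verts Q. int (vector_space.dim (*) (U i)))"

definition dim_lattice :: "('v, 'a) pre_digraph \<Rightarrow> ('v \<Rightarrow> int) monoid" where
  "dim_lattice Q = product_group (verts Q) (\<lambda>_. integer_group)"

text \<open>A \<open>\<int>\<close>-linear map is the same as a homomorphism of additive groups.\<close>

definition stability_condition :: "('v, 'a) pre_digraph \<Rightarrow> (('v \<Rightarrow> int) \<Rightarrow> int) \<Rightarrow> bool" where
  "stability_condition Q \<theta> \<longleftrightarrow> \<theta> \<in> hom (dim_lattice Q) integer_group"

definition slope :: "('v, 'a) pre_digraph \<Rightarrow> (('v \<Rightarrow> int) \<Rightarrow> int) \<Rightarrow> ('v \<Rightarrow> int) \<Rightarrow> rat" where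
  "slope Q \<theta> e = of_int (\<theta> e) / of_int (\<Sum>i\<in>verts Q. e i)"

definition stable ::
    "('v, 'a) pre_digraph \<Rightarrow> (('v \<Rightarrow> int) \<Rightarrow> int) \<Rightarrow> ('a \<Rightarrow> 'k::field) \<Rightarrow> bool" where
  "stable Q \<theta> M \<longleftrightarrow>
     (\<forall>U. subrep Q M U \<and> (\<exists>i\<in>verts Q. U i \<noteq> {0}) \<and> (\<exists>i\<in>verts Q. U i \<noteq> UNIV) \<longrightarrow>
        slope Q \<theta> (dim_vector Q U) < slope Q \<theta> (\<lambda>i\<in>verts Q. 1))"

definition stable_locus ::
    "('v, 'a) pre_digraph \<Rightarrow> (('v \<Rightarrow> int) \<Rightarrow> int) \<Rightarrow> ('a \<Rightarrow> 'k::field) set" where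
  "stable_locus Q \<theta> = {M \<in> rep_space Q. stable Q \<theta> M}"

definition stable_spanning_tree ::
    "'k::field itself \<Rightarrow> ('v, 'a) pre_digraph \<Rightarrow> (('v \<Rightarrow> int) \<Rightarrow> int) \<Rightarrow> 'a set \<Rightarrow> bool" where
  "stable_spanning_tree _ Q \<theta> H \<longleftrightarrow>
     quiver_spanning_tree Q H \<and> stable Q \<theta> (indicator_rep Q H :: 'a \<Rightarrow> 'k)"


section \<open>The points of the moduli space and the torus action\<close>

text \<open>
  Elements of \<^term>\<open>PG Q\<close> and \<^term>\<open>T0 Q\<close> are cosets. All elements of a coset \<open>D\<close> of the
  diagonal act in the same way; a coset \<open>C\<close> of the image of \<^const>\<open>sigma\<close> sends an orbit \<open>X\<close> to
  the set of all \<open>t.N\<close> with \<open>t \<in> C\<close> and \<open>N \<in> X\<close>, which is again an orbit. Both are group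
  actions, see \<open>group_action_PG\<close> and \<open>group_action_T0\<close> below.
\<close>

definition PG_act ::
    "('v, 'a) pre_digraph \<Rightarrow> (('v \<Rightarrow> int) \<Rightarrow> int) \<Rightarrow> ('v \<Rightarrow> 'k::field) set
      \<Rightarrow> ('a \<Rightarrow> 'k) \<Rightarrow> ('a \<Rightarrow> 'k)" where
  "PG_act Q \<theta> D = (\<lambda>M\<in>stable_locus Q \<theta>. the_elem ((\<lambda>g. base_act Q g M) ` D))"

definition moduli ::
    "('v, 'a) pre_digraph \<Rightarrow> (('v \<Rightarrow> int) \<Rightarrow> int) \<Rightarrow> ('a \<Rightarrow> 'k::field) set set" where
  "moduli Q \<theta> = orbits (PG Q) (stable_locus Q \<theta>) (PG_act Q \<theta>)"

definition moduli_point ::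
    "('v, 'a) pre_digraph \<Rightarrow> (('v \<Rightarrow> int) \<Rightarrow> int) \<Rightarrow> ('a \<Rightarrow> 'k::field) \<Rightarrow> ('a \<Rightarrow> 'k) set" where
  "moduli_point Q \<theta> M = Group_Action.orbit (PG Q) (PG_act Q \<theta>) M"

definition T0_act ::
    "('v, 'a) pre_digraph \<Rightarrow> (('v \<Rightarrow> int) \<Rightarrow> int) \<Rightarrow> ('a \<Rightarrow> 'k::field) set
      \<Rightarrow> ('a \<Rightarrow> 'k) set \<Rightarrow> ('a \<Rightarrow> 'k) set" where
  "T0_act Q \<theta> C = (\<lambda>X\<in>moduli Q \<theta>. {arrow_act Q t N | t N. t \<in> C \<and> N \<in> X})"

definition T0_fixed_points ::
    "('v, 'a) pre_digraph \<Rightarrow> (('v \<Rightarrow> int) \<Rightarrow> int) \<Rightarrow> ('a \<Rightarrow> 'k::field) set set" where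
  "T0_fixed_points Q \<theta> = {X \<in> moduli Q \<theta>. \<forall>C\<in>carrier (T0 Q). T0_act Q \<theta> C X = X}"


subsection \<open>Well-definedness\<close>

lemma comm_group_Gm [simp]: "comm_group (Gm :: 'k::field monoid)"
  by (rule comm_groupI)
     (auto simp: Gm_def mult.commute mult.assoc intro!: bexI[where x = "inverse _"])

lemma carrier_torus: "carrier (torus I) = (I \<rightarrow>\<^sub>E UNIV - {0})"
  by (simp add: torus_def Gm_def)

lemma mult_torus: "t \<otimes>\<^bsub>torus I\<^esub> u = (\<lambda>i\<in>I. t i * u i)"
  by (simp add: torus_def Gm_def)

lemma one_torus: "\<one>\<^bsub>torus I\<^esub> = (\<lambda>i\<in>I. 1)"
  by (simp add: torus_def Gm_def)

lemma group_torus [simp]: "group (torus I)"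
  unfolding torus_def by (rule product_group) (simp add: comm_group.axioms(2))

lemma comm_group_torus [simp]: "comm_group (torus I)"
  by (rule group.group_comm_groupI) (auto simp: mult_torus mult.commute)

context
  fixes Q :: "('v, 'a) pre_digraph"
  assumes Q: "wf_digraph Q"
begin

lemma arrow_ends: "\<alpha> \<in> arcs Q \<Longrightarrow> head Q \<alpha> \<in> verts Q" "\<alpha> \<in> arcs Q \<Longrightarrow> tail Q \<alpha> \<in> verts Q"
  using Q by (simp_all add: wf_digraph.head_in_verts wf_digraph.tail_in_verts)

lemma group_hom_sigma: "group_hom (torus (verts Q)) (torus (arcs Q)) (sigma Q)"
proof -
  have "sigma Q \<in> hom (torus (verts Q)) (torus (arcs Q))"
    by (rule homI) (auto simp: sigma_def carrier_torus mult_torus PiE_iff arrow_ends fun_eq_iff)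
  then show ?thesis
    by (simp add: group_hom_def group_hom_axioms_def)
qed

lemma normal_sigma_image: "sigma_image Q \<lhd> torus (arcs Q)"
  unfolding sigma_image_def
  by (intro comm_group.subgroup_imp_normal group_hom.img_is_subgroup[OF group_hom_sigma])
     simp

lemma normal_diag: "diag Q \<lhd> torus (verts Q)"
proof (rule comm_group.subgroup_imp_normal)
  have "group_hom Gm (torus (verts Q)) (\<lambda>c. \<lambda>i\<in>verts Q. c)"
    by (auto simp: group_hom_def group_hom_axioms_def comm_group.axioms(2) hom_def mult_torus
        carrier_torus fun_eq_iff Gm_def intro: comm_group.axioms(2)[OF comm_group_Gm, unfolded Gm_def])
  then show "subgroup (diag Q) (torus (verts Q))"
    unfolding diag_def by (rule group_hom.img_is_subgroup)
qed simp

lemma group_T0: "group (T0 Q)"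
  unfolding T0_def by (rule normal.factorgroup_is_group[OF normal_sigma_image])

lemma group_PG: "group (PG Q)"
  unfolding PG_def by (rule normal.factorgroup_is_group[OF normal_diag])

lemma base_act_eq: "base_act Q g M = arrow_act Q (sigma Q g) M"
  by (auto simp: base_act_def arrow_act_def sigma_def fun_eq_iff)

lemma sigma_in_torus: "g \<in> carrier (torus (verts Q)) \<Longrightarrow> sigma Q g \<in> carrier (torus (arcs Q))"
  by (rule group_hom.hom_closed[OF group_hom_sigma])

lemma arrow_act_mult:
  "arrow_act Q (t \<otimes>\<^bsub>torus (arcs Q)\<^esub> u) M = arrow_act Q t (arrow_act Q u M)"
  by (auto simp: arrow_act_def mult_torus fun_eq_iff)

lemma subrep_arrow_act:
  fixes t :: "'a \<Rightarrow> 'k::field"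
  assumes "t \<in> carrier (torus (arcs Q))"
  shows "subrep Q (arrow_act Q t M) U \<longleftrightarrow> subrep Q M U"
proof -
  have vs: "module ((*) :: 'k \<Rightarrow> 'k \<Rightarrow> 'k)"
    by unfold_locales (auto simp: algebra_simps)
  have scale: "c * x \<in> W \<longleftrightarrow> x \<in> W" if "module.subspace (*) W" "c \<noteq> 0" for c x :: 'k and W
    using module.subspace_scale[OF vs that(1), of x c]
      module.subspace_scale[OF vs that(1), of "c * x" "inverse c"] that(2)
    by (auto simp flip: mult.assoc)
  have "t \<alpha> \<noteq> 0" if "\<alpha> \<in> arcs Q" for \<alpha>
    using assms that by (auto simp: carrier_torus)
  then show ?thesis
    unfolding subrep_def arrow_act_def by (auto simp: scale arrow_ends mult.assoc)
qed

lemma arrow_act_stable: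
  assumes "t \<in> carrier (torus (arcs Q))" "M \<in> stable_locus Q \<theta>"
  shows "arrow_act Q t M \<in> stable_locus Q \<theta>"
  using assms subrep_arrow_act[OF assms(1)]
  by (auto simp: stable_locus_def stable_def rep_space_def) (auto simp: arrow_act_def)

lemma group_actionI:
  assumes "group G"
    and ext: "\<And>g. g \<in> carrier G \<Longrightarrow> \<phi> g \<in> extensional E"
    and closed: "\<And>g x. g \<in> carrier G \<Longrightarrow> x \<in> E \<Longrightarrow> \<phi> g x \<in> E"
    and one: "\<And>x. x \<in> E \<Longrightarrow> \<phi> \<one>\<^bsub>G\<^esub> x = x"
    and mult: "\<And>g h x. g \<in> carrier G \<Longrightarrow> h \<in> carrier G \<Longrightarrow> x \<in> E \<Longrightarrow> \<phi> (g \<otimes>\<^bsub>G\<^esub> h) x = \<phi> g (\<phi> h x)"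
  shows "group_action G E \<phi>"
proof -
  interpret group G by fact
  have inv: "\<phi> (inv\<^bsub>G\<^esub> g) (\<phi> g x) = x" "\<phi> g (\<phi> (inv\<^bsub>G\<^esub> g) x) = x" if "g \<in> carrier G" "x \<in> E" for g x
    using that mult[of "inv\<^bsub>G\<^esub> g" g x] mult[of g "inv\<^bsub>G\<^esub> g" x] one by simp_all
  have bij: "\<phi> g \<in> Bij E" if "g \<in> carrier G" for g
    unfolding Bij_def
    using that inv closed ext by (auto intro!: bij_betw_byWitness[where f' = "\<phi> (inv\<^bsub>G\<^esub> g)"])
  have "\<phi> (g \<otimes>\<^bsub>G\<^esub> h) = compose E (\<phi> g) (\<phi> h)" if "g \<in> carrier G" "h \<in> carrier G" for g h
    using that ext[of "g \<otimes>\<^bsub>G\<^esub> h"] mult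
    by (auto simp: compose_def fun_eq_iff extensional_def)
  with bij have "\<phi> \<in> hom G (BijGroup E)"
    by (auto simp: hom_def BijGroup_def)
  then show ?thesis
    by (simp add: group_action_def group_hom_def group_hom_axioms_def group_BijGroup assms(1))
qed

lemma PG_act_coset:
  fixes g :: "'v \<Rightarrow> 'k::field"
  assumes g: "g \<in> carrier (torus (verts Q))" and M: "M \<in> stable_locus Q \<theta>"
  shows "PG_act Q \<theta> (diag Q #>\<^bsub>torus (verts Q)\<^esub> g) M = base_act Q g M"
proof -
  have same: "base_act Q ((\<lambda>i\<in>verts Q. c) \<otimes>\<^bsub>torus (verts Q)\<^esub> g) M = base_act Q g M"
    if "c \<noteq> 0" for c
    using that by (auto simp: base_act_def mult_torus arrow_ends fun_eq_iff)
  have "diag Q #>\<^bsub>torus (verts Q)\<^esub> g =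
      (\<lambda>c. (\<lambda>i\<in>verts Q. c) \<otimes>\<^bsub>torus (verts Q)\<^esub> g) ` (UNIV - {0})"
    by (auto simp: r_coset_def diag_def Gm_def)
  then have "(\<lambda>h. base_act Q h M) ` (diag Q #>\<^bsub>torus (verts Q)\<^esub> g) =
      (\<lambda>c. base_act Q g M) ` (UNIV - {0 :: 'k})"
    unfolding image_image by (simp add: image_image same cong: image_cong_simp)
  also have "\<dots> = {base_act Q g M}"
    using one_neq_zero by blast
  finally have "(\<lambda>h. base_act Q h M) ` (diag Q #>\<^bsub>torus (verts Q)\<^esub> g) = {base_act Q g M}" .
  then show ?thesis
    using M by (simp add: PG_act_def)
qed

lemma carrier_PG: "carrier (PG Q) = (\<lambda>g. diag Q #>\<^bsub>torus (verts Q)\<^esub> g) ` carrier (torus (verts Q))"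
  by (auto simp: PG_def FactGroup_def RCOSETS_def)

lemma carrier_T0:
  "carrier (T0 Q) = T0_proj Q ` carrier (torus (arcs Q))"
  by (auto simp: T0_def T0_proj_def FactGroup_def RCOSETS_def)

lemma stable_rep_space: "M \<in> stable_locus Q \<theta> \<Longrightarrow> M \<in> rep_space Q"
  by (simp add: stable_locus_def)

lemma group_action_PG: "group_action (PG Q) (stable_locus Q \<theta>) (PG_act Q \<theta> :: ('v \<Rightarrow> 'k::field) set \<Rightarrow> _)"
proof (rule group_actionI[OF group_PG])
  let ?G = "torus (verts Q) :: ('v \<Rightarrow> 'k) monoid"
  show "PG_act Q \<theta> D \<in> extensional (stable_locus Q \<theta>)" for D :: "('v \<Rightarrow> 'k) set"
    by (simp add: PG_act_def)
  show "PG_act Q \<theta> D M \<in> stable_locus Q \<theta>"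
    if "D \<in> carrier (PG Q)" "M \<in> stable_locus Q \<theta>" for D and M :: "'a \<Rightarrow> 'k"
    using that by (auto simp: carrier_PG PG_act_coset base_act_eq intro!: arrow_act_stable sigma_in_torus)
  show "PG_act Q \<theta> \<one>\<^bsub>PG Q\<^esub> M = M" if M: "M \<in> stable_locus Q \<theta>" for M :: "'a \<Rightarrow> 'k"
  proof -
    have "\<one>\<^bsub>PG Q\<^esub> = diag Q #>\<^bsub>?G\<^esub> \<one>\<^bsub>?G\<^esub>"
      by (simp add: PG_def group.coset_mult_one[OF group_torus]
          subgroup.subset[OF normal_imp_subgroup[OF normal_diag]])
    moreover have "base_act Q \<one>\<^bsub>?G\<^esub> M = M"
      using stable_rep_space[OF M]
      by (auto simp: base_act_def one_torus arrow_ends fun_eq_iff rep_space_def PiE_iff extensional_def)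
    ultimately show ?thesis
      using M by (simp add: PG_act_coset monoid.one_closed[OF group.is_monoid])
  qed
  show "PG_act Q \<theta> (D \<otimes>\<^bsub>PG Q\<^esub> E) M = PG_act Q \<theta> D (PG_act Q \<theta> E M)"
    if D: "D \<in> carrier (PG Q)" and E: "E \<in> carrier (PG Q)" and M: "M \<in> stable_locus Q \<theta>"
    for D E and M :: "'a \<Rightarrow> 'k"
  proof -
    from D obtain g where g: "g \<in> carrier ?G" "D = diag Q #>\<^bsub>?G\<^esub> g" by (auto simp: carrier_PG)
    from E obtain h where h: "h \<in> carrier ?G" "E = diag Q #>\<^bsub>?G\<^esub> h" by (auto simp: carrier_PG)
    have "D \<otimes>\<^bsub>PG Q\<^esub> E = diag Q #>\<^bsub>?G\<^esub> (g \<otimes>\<^bsub>?G\<^esub> h)"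
      using g h by (simp add: PG_def normal.rcos_sum[OF normal_diag])
    then show ?thesis
      using g h M
      by (simp add: PG_act_coset monoid.m_closed[OF group.is_monoid] base_act_eq arrow_act_stable
          sigma_in_torus group_hom.hom_mult[OF group_hom_sigma] arrow_act_mult)
  qed
qed

lemma moduli_point_eq_base_orbit:
  assumes "M \<in> stable_locus Q \<theta>"
  shows "moduli_point Q \<theta> M = {base_act Q g M | g. g \<in> carrier (torus (verts Q))}"
  using assms
  by (auto simp: moduli_point_def Group_Action.orbit_def carrier_PG PG_act_coset) (metis PG_act_coset imageI)

lemma moduli_point_eq_iso_class:
  fixes M :: "'a \<Rightarrow> 'k::field"
  assumes M: "M \<in> stable_locus Q \<theta>"
  shows "moduli_point Q \<theta> M = {N \<in> rep_space Q. rep_iso Q M N}"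
proof (rule Set.set_eqI, rule iffI)
  fix N assume "N \<in> moduli_point Q \<theta> M"
  then obtain g where g: "g \<in> carrier (torus (verts Q))" and N: "N = base_act Q g M"
    using moduli_point_eq_base_orbit[OF M] by auto
  have nz: "\<forall>i\<in>verts Q. g i \<noteq> 0" using g by (auto simp: carrier_torus)
  then have "rep_iso Q M N"
    unfolding rep_iso_def by (intro exI[of _ g]) (auto simp: N base_act_def arrow_ends)
  then show "N \<in> {N \<in> rep_space Q. rep_iso Q M N}"
    by (simp add: N rep_space_def base_act_def)
next
  fix N assume "N \<in> {N \<in> rep_space Q. rep_iso Q M N}"
  then obtain f where N: "N \<in> rep_space Q" and nz: "\<forall>i\<in>verts Q. f i \<noteq> 0"
    and f: "\<forall>\<alpha>\<in>arcs Q. f (head Q \<alpha>) * M \<alpha> = N \<alpha> * f (tail Q \<alpha>)"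
    by (auto simp: rep_iso_def)
  have "N \<alpha> = base_act Q (restrict f (verts Q)) M \<alpha>" for \<alpha>
  proof (cases "\<alpha> \<in> arcs Q")
    case True
    with f nz arrow_ends[of \<alpha>] show ?thesis
      by (auto simp: base_act_def field_simps)
  next
    case False
    with N show ?thesis by (auto simp: base_act_def rep_space_def PiE_iff extensional_def)
  qed
  then have "N = base_act Q (restrict f (verts Q)) M" by blast
  moreover have "restrict f (verts Q) \<in> carrier (torus (verts Q))"
    using nz by (auto simp: carrier_torus)
  ultimately show "N \<in> moduli_point Q \<theta> M"
    unfolding moduli_point_eq_base_orbit[OF M] by blast
qed

lemma moduli_eq: "moduli Q \<theta> = moduli_point Q \<theta> ` stable_locus Q \<theta>"
  by (auto simp: moduli_def moduli_point_def orbits_def)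

text \<open>The action of \<open>T\<close> descends to the quotient and factors through \<^term>\<open>T0 Q\<close>.\<close>

lemma T0_act_moduli_point:
  fixes M :: "'a \<Rightarrow> 'k::field"
  assumes t: "t \<in> carrier (torus (arcs Q))" and M: "M \<in> stable_locus Q \<theta>"
  shows "T0_act Q \<theta> (T0_proj Q t) (moduli_point Q \<theta> M) = moduli_point Q \<theta> (arrow_act Q t M)"
proof -
  let ?G = "torus (verts Q) :: ('v \<Rightarrow> 'k) monoid" and ?T = "torus (arcs Q) :: ('a \<Rightarrow> 'k) monoid"
  interpret G: group ?G by simp
  have step: "arrow_act Q (sigma Q g \<otimes>\<^bsub>?T\<^esub> t) (arrow_act Q (sigma Q h) M) =
      arrow_act Q (sigma Q (g \<otimes>\<^bsub>?G\<^esub> h)) (arrow_act Q t M)"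
    if "g \<in> carrier ?G" "h \<in> carrier ?G" for g h
    using that
    by (subst group_hom.hom_mult[OF group_hom_sigma]) (auto simp: arrow_act_def mult_torus fun_eq_iff)
  have coset: "T0_proj Q t = {sigma Q g \<otimes>\<^bsub>?T\<^esub> t | g. g \<in> carrier ?G}"
    by (auto simp: T0_proj_def r_coset_def sigma_image_def)
  have pt: "moduli_point Q \<theta> M \<in> moduli Q \<theta>"
    using M by (simp add: moduli_eq)
  have "T0_act Q \<theta> (T0_proj Q t) (moduli_point Q \<theta> M) =
      {arrow_act Q (sigma Q g \<otimes>\<^bsub>?T\<^esub> t) (arrow_act Q (sigma Q h) M) | g h.
         g \<in> carrier ?G \<and> h \<in> carrier ?G}"
    unfolding T0_act_def coset restrict_apply'[OF pt]
    by (auto simp: moduli_point_eq_base_orbit[OF M] base_act_eq)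
  also have "\<dots> = {arrow_act Q (sigma Q (g \<otimes>\<^bsub>?G\<^esub> h)) (arrow_act Q t M) | g h.
         g \<in> carrier ?G \<and> h \<in> carrier ?G}"
    using step by (intro Collect_cong) metis
  also have "\<dots> = {arrow_act Q (sigma Q g) (arrow_act Q t M) | g. g \<in> carrier ?G}"
    by (intro Collect_cong iffI; elim exE conjE) (use G.m_closed G.r_one G.one_closed in metis)+
  also have "\<dots> = moduli_point Q \<theta> (arrow_act Q t M)"
    by (simp add: moduli_point_eq_base_orbit[OF arrow_act_stable[OF t M]] base_act_eq)
  finally show ?thesis .
qed

lemma group_action_T0: "group_action (T0 Q) (moduli Q \<theta>) (T0_act Q \<theta> :: ('a \<Rightarrow> 'k::field) set \<Rightarrow> _)"
proof (rule group_actionI[OF group_T0])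
  let ?T = "torus (arcs Q) :: ('a \<Rightarrow> 'k) monoid"
  show "T0_act Q \<theta> C \<in> extensional (moduli Q \<theta>)" for C :: "('a \<Rightarrow> 'k) set"
    by (simp add: T0_act_def)
  show "T0_act Q \<theta> C X \<in> moduli Q \<theta>" if "C \<in> carrier (T0 Q)" "X \<in> moduli Q \<theta>"
    for C and X :: "('a \<Rightarrow> 'k) set"
    using that by (auto simp: carrier_T0 moduli_eq T0_act_moduli_point arrow_act_stable)
  show "T0_act Q \<theta> \<one>\<^bsub>T0 Q\<^esub> X = X" if "X \<in> moduli Q \<theta>" for X :: "('a \<Rightarrow> 'k) set"
  proof -
    from that obtain M where M: "M \<in> stable_locus Q \<theta>" "X = moduli_point Q \<theta> M"
      by (auto simp: moduli_eq)
    have "\<one>\<^bsub>T0 Q\<^esub> = T0_proj Q \<one>\<^bsub>?T\<^esub>"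
      by (simp add: T0_def T0_proj_def group.coset_mult_one[OF group_torus]
          subgroup.subset[OF normal_imp_subgroup[OF normal_sigma_image]])
    moreover have "arrow_act Q \<one>\<^bsub>?T\<^esub> M = M"
      using stable_rep_space[OF M(1)]
      by (auto simp: arrow_act_def one_torus fun_eq_iff rep_space_def PiE_iff extensional_def)
    ultimately show ?thesis
      using M by (simp add: T0_act_moduli_point monoid.one_closed[OF group.is_monoid])
  qed
  show "T0_act Q \<theta> (C \<otimes>\<^bsub>T0 Q\<^esub> D) X = T0_act Q \<theta> C (T0_act Q \<theta> D X)"
    if C: "C \<in> carrier (T0 Q)" and D: "D \<in> carrier (T0 Q)" and X: "X \<in> moduli Q \<theta>"
    for C D and X :: "('a \<Rightarrow> 'k) set"
  proof -
    from C obtain t where t: "t \<in> carrier ?T" "C = T0_proj Q t" by (auto simp: carrier_T0)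
    from D obtain u where u: "u \<in> carrier ?T" "D = T0_proj Q u" by (auto simp: carrier_T0)
    from X obtain M where M: "M \<in> stable_locus Q \<theta>" "X = moduli_point Q \<theta> M"
      by (auto simp: moduli_eq)
    have "C \<otimes>\<^bsub>T0 Q\<^esub> D = T0_proj Q (t \<otimes>\<^bsub>?T\<^esub> u)"
      using t u by (simp add: T0_def T0_proj_def normal.rcos_sum[OF normal_sigma_image])
    then show ?thesis
      using t u M
      by (simp add: T0_act_moduli_point monoid.m_closed[OF group.is_monoid] arrow_act_stable
          arrow_act_mult)
  qed
qed

end

end

theory Submission
  imports Defs
begin

text \<open>
  A point \<open>[M]\<close> is fixed iff every \<open>t \<in> T\<close> agrees with some \<^term>\<open>sigma Q g\<close> on the
  support \<open>H\<close> of \<open>M\<close>.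
  Stability forces \<open>H\<close> to be connected. Around an unoriented cycle the product of the ratios of \<open>g\<close>
  is trivial, so \<open>t\<close> cannot be arbitrary on \<open>H\<close> if there is one; on a forest, potentials \<open>g\<close> with
  arbitrary ratios exist. They can be chosen as Laurent monomials in \<open>t\<close>, which makes the splitting
  \<open>T = sigma(G) S\<close>, for \<open>S\<close> the torus of the complement of the tree, algebraic,
  while connectedness of the tree makes the factors intersect trivially.
\<close>

section \<open>Trees and potentials\<close>

lemma doubled_simps [simp]:
  "verts (doubled Q) = verts Q"
  "arcs (doubled Q) = arcs Q \<times> UNIV"
  "tail (doubled Q) (\<alpha>, b) = (if b then tail Q \<alpha> else head Q \<alpha>)"
  "head (doubled Q) (\<alpha>, b) = (if b then head Q \<alpha> else tail Q \<alpha>)"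
  by (simp_all add: doubled_def)

lemma wf_digraph_doubled: "wf_digraph Q \<Longrightarrow> wf_digraph (doubled Q)"
  by (auto simp: wf_digraph_def)

lemma wf_digraph_arcs_update: "wf_digraph Q \<Longrightarrow> H \<subseteq> arcs Q \<Longrightarrow> wf_digraph (Q\<lparr>arcs := H\<rparr>)"
  by (auto simp: wf_digraph_def)

text \<open>Equality is symmetric, so the direction in which an arrow is traversed does not matter
  and the values propagate along the walk.\<close>

lemma cas_doubled_constant:
  assumes "pre_digraph.cas (doubled Q) u p v"
    and "\<forall>e\<in>set p. g (head Q (fst e)) = g (tail Q (fst e))"
  shows "g u = g v"
  using assms
proof (induction p arbitrary: u)
  case Nil
  then show ?case by (simp add: pre_digraph.cas.simps)
next
  case (Cons e p)
  have "g (head (doubled Q) e) = g v"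
    using Cons by (simp add: pre_digraph.cas.simps)
  moreover have "g (head (doubled Q) e) = g u"
    using Cons.prems by (cases e) (auto simp: pre_digraph.cas.simps)
  ultimately show ?case by simp
qed

text \<open>Any traversal of an arrow, in either direction, visits both of its ends. Using the first
  arrow again would therefore revisit the starting vertex. This supplies the distinctness of arrows
  that \<open>unoriented_cycle\<close> demands.\<close>

lemma apath_doubled_distinct:
  assumes "wf_digraph Q" "pre_digraph.apath (doubled Q) u p v"
  shows "distinct (map fst p)"
  using assms(2)
proof (induction p arbitrary: u)
  case (Cons e p)
  interpret D: wf_digraph "doubled Q" using assms(1) by (rule wf_digraph_doubled)
  obtain a b where e: "e = (a, b)" by (cases e)
  have path: "D.apath (head (doubled Q) e) p v"
    and notin: "tail (doubled Q) e \<notin> set (D.awalk_verts (head (doubled Q) e) p)"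
    using Cons.prems unfolding D.apath_Cons_iff by blast+
  have "a \<notin> fst ` set p"
  proof
    assume "a \<in> fst ` set p"
    then obtain c where c: "(a, c) \<in> set p" by auto
    have "tail (doubled Q) (a, c) \<in> set (D.awalk_verts (head (doubled Q) e) p)"
      using c by (rule D.awalk_verts_arc1)
    moreover have "head (doubled Q) (a, c) \<in> set (D.awalk_verts (head (doubled Q) e) p)"
      using D.awalkI_apath[OF path] c by (rule D.awalk_verts_arc2)
    ultimately show False
      using notin by (auto simp: e split: if_splits)
  qed
  with Cons.IH[OF path] show ?case by (simp add: e)
qed simp

text \<open>Cuts are the form of connectedness that fits stability, where subrepresentations are
  tested on vertex sets.\<close>

lemma connected_iff_no_separation:
  assumes "wf_digraph G"
  shows "Digraph_Component.connected G \<longleftrightarrow> verts G \<noteq> {} \<and>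
    (\<forall>S\<subseteq>verts G. S \<noteq> {} \<longrightarrow> (\<forall>a\<in>arcs G. tail G a \<in> S \<longleftrightarrow> head G a \<in> S) \<longrightarrow> S = verts G)"
    (is "_ \<longleftrightarrow> _ \<and> ?R")
proof -
  let ?E = "rtrancl_on (verts G) ((arcs_ends G)\<^sup>s)"
  have sym: "(u, v) \<in> (arcs_ends G)\<^sup>s \<longleftrightarrow>
      (\<exists>a\<in>arcs G. (u = tail G a \<and> v = head G a) \<or> (u = head G a \<and> v = tail G a))" for u v
    by (auto simp: symcl_def arcs_ends_conv)
  have "?R \<longleftrightarrow> (\<forall>u\<in>verts G. \<forall>v\<in>verts G. (u, v) \<in> ?E)"
  proof
    assume R: ?R
    show "\<forall>u\<in>verts G. \<forall>v\<in>verts G. (u, v) \<in> ?E"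
    proof (intro ballI)
      fix u v assume u: "u \<in> verts G" and v: "v \<in> verts G"
      \<comment> \<open>The unoriented component of \<open>u\<close> is closed under arrows in both
        directions.\<close>
      let ?S = "{w. (u, w) \<in> ?E}"
      have step: "w' \<in> ?S" if "w \<in> ?S" "(w, w') \<in> (arcs_ends G)\<^sup>s" "w' \<in> verts G" for w w'
        using that by (auto intro: rtrancl_on_into_rtrancl_on)
      have "w \<in> verts G" if "(u, w) \<in> ?E" for w
        using that by (induction rule: rtrancl_on_induct) auto
      then have "?S \<subseteq> verts G" by blast
      moreover have "u \<in> ?S" using u by simp
      moreover have "\<forall>a\<in>arcs G. tail G a \<in> ?S \<longleftrightarrow> head G a \<in> ?S"
        using step assms unfolding sym wf_digraph_def by blast
      ultimately have "?S = verts G" using R by blast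
      then show "(u, v) \<in> ?E" using v by blast
    qed
  next
    assume E: "\<forall>u\<in>verts G. \<forall>v\<in>verts G. (u, v) \<in> ?E"
    show ?R
    proof (intro allI impI)
      fix S assume S: "S \<subseteq> verts G" "S \<noteq> {}"
        and closed: "\<forall>a\<in>arcs G. tail G a \<in> S \<longleftrightarrow> head G a \<in> S"
      obtain u where u: "u \<in> S" using S by auto
      have "v \<in> S" if "v \<in> verts G" for v
      proof -
        have "(u, v) \<in> ?E" using E S u that by blast
        then show ?thesis
          by (induction rule: rtrancl_on_induct) (use u closed in \<open>auto simp: sym\<close>)
      qed
      with S show "S = verts G" by blast
    qed
  qed
  then show ?thesis by (simp add: connected_conv)
qed

text \<open>The level set of \<open>g\<close> through \<open>u\<close> is non-empty and is not left
  by any arrow, so it contains every vertex.\<close>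

lemma connected_constant:
  assumes "wf_digraph G" "Digraph_Component.connected G"
    and "\<And>a. a \<in> arcs G \<Longrightarrow> g (head G a) = g (tail G a)"
    and "u \<in> verts G" "v \<in> verts G"
  shows "g u = g v"
proof -
  have "S = verts G"
    if "S \<subseteq> verts G" "S \<noteq> {}" "\<forall>a\<in>arcs G. tail G a \<in> S \<longleftrightarrow> head G a \<in> S" for S
    using assms(2) that by (simp add: connected_iff_no_separation[OF assms(1)])
  from this[of "{w \<in> verts G. g w = g u}"] have "{w \<in> verts G. g w = g u} = verts G"
    using assms by (auto simp: wf_digraph_def)
  with \<open>v \<in> verts G\<close> have "v \<in> {w \<in> verts G. g w = g u}" by simp
  then show ?thesis by simp
qed


section \<open>Regular functions on a torus\<close>

text \<open>Restricting to the torus here allows plain lambda terms instead of extensional functions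
  in the closure rules.\<close>

definition regular :: "'i set \<Rightarrow> (('i \<Rightarrow> 'k::field) \<Rightarrow> 'k) \<Rightarrow> bool" where
  "regular I f \<longleftrightarrow> restrict f (carrier (torus I)) \<in> torus_functions I"

lemma regular_cong:
  "(\<And>t. t \<in> carrier (torus I) \<Longrightarrow> f t = h t) \<Longrightarrow> regular I f \<longleftrightarrow> regular I h"
  unfolding regular_def by (metis restrict_ext)

lemma regular_const: "regular I (\<lambda>t. c)"
  unfolding regular_def by (rule torus_functions.const)

lemma regular_coord: "i \<in> I \<Longrightarrow> regular I (\<lambda>t. t i)"
  unfolding regular_def by (rule torus_functions.coord)

lemma regular_coord_inverse: "i \<in> I \<Longrightarrow> regular I (\<lambda>t. inverse (t i))"
  unfolding regular_def by (rule torus_functions.coord_inverse)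

lemma regular_add:
  assumes "regular I f" "regular I h"
  shows "regular I (\<lambda>t. f t + h t)"
  using torus_functions.add[OF assms[unfolded regular_def]]
  by (simp add: regular_def cong: restrict_cong)

lemma regular_mult:
  assumes "regular I f" "regular I h"
  shows "regular I (\<lambda>t. f t * h t)"
  using torus_functions.mult[OF assms[unfolded regular_def]]
  by (simp add: regular_def cong: restrict_cong)

text \<open>These are the units of the ring of Laurent polynomials. Non-vanishing is a separate
  clause because \<open>inverse 0 = 0\<close> lets the zero function satisfy the first two.\<close>

definition regular_unit :: "'i set \<Rightarrow> (('i \<Rightarrow> 'k::field) \<Rightarrow> 'k) \<Rightarrow> bool" where
  "regular_unit I f \<longleftrightarrow> regular I f \<and> regular I (\<lambda>t. inverse (f t)) \<and>
     (\<forall>t\<in>carrier (torus I). f t \<noteq> 0)"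

lemma regular_unit_one: "regular_unit I (\<lambda>t. 1)"
  by (simp add: regular_unit_def regular_const)

lemma regular_unit_coord: "i \<in> I \<Longrightarrow> regular_unit I (\<lambda>t. t i)"
  by (auto simp: regular_unit_def regular_coord regular_coord_inverse carrier_torus)

lemma regular_unit_inverse: "regular_unit I f \<Longrightarrow> regular_unit I (\<lambda>t. inverse (f t))"
  by (simp add: regular_unit_def)

lemma regular_unit_mult:
  "regular_unit I f \<Longrightarrow> regular_unit I h \<Longrightarrow> regular_unit I (\<lambda>t. f t * h t)"
  by (simp add: regular_unit_def regular_mult)

text \<open>Induction over the generators of the ring. Units are required because an inverse
  coordinate pulls back to the inverse of a component of \<open>r\<close>.\<close>

lemma regular_compose:
  assumes f: "f \<in> torus_functions I"
    and r: "\<And>t. t \<in> carrier (torus J) \<Longrightarrow> r t \<in> carrier (torus I)"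
    and unit: "\<And>i. i \<in> I \<Longrightarrow> regular_unit J (\<lambda>t. r t i)"
  shows "regular J (\<lambda>t. f (r t))"
  using f
proof induction
  case (const c)
  then show ?case using r by (simp add: regular_const cong: regular_cong)
next
  case (coord i)
  then show ?case using r unit[of i] by (simp add: regular_unit_def cong: regular_cong)
next
  case (coord_inverse i)
  then show ?case using r unit[of i] by (simp add: regular_unit_def cong: regular_cong)
next
  case (add f h)
  then show ?case using r regular_add[OF add.IH] by (simp cong: regular_cong)
next
  case (mult f h)
  then show ?case using r regular_mult[OF mult.IH] by (simp cong: regular_cong)
qed


section \<open>Potentials on forests\<close>

text \<open>
  Removing an arrow \<open>\<alpha>\<close> from a forest separates its ends, so the potential of the smaller forest can
  be rescaled on the component of \<^term>\<open>head Q \<alpha>\<close> to take the prescribed ratio along \<open>\<alpha>\<close>.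
\<close>

lemma forest_potential:
  fixes Q :: "('v, 'a) pre_digraph"
  assumes Q: "wf_digraph Q" and H: "finite H" "H \<subseteq> arcs Q" "H \<subseteq> I"
    and acyc: "\<not> (\<exists>p. unoriented_cycle (Q\<lparr>arcs := H\<rparr>) p)"
  shows "\<exists>g :: ('a \<Rightarrow> 'k::field) \<Rightarrow> 'v \<Rightarrow> 'k.
    (\<forall>i. regular_unit I (\<lambda>t. g t i)) \<and>
    (\<forall>t\<in>carrier (torus I). \<forall>\<alpha>\<in>H. g t (head Q \<alpha>) = t \<alpha> * g t (tail Q \<alpha>))"
proof -
  \<comment> \<open>The induction adds arrows to a subset \<open>F\<close>, while the absence of
    cycles stays a statement about \<open>H\<close>.\<close>
  have "\<exists>g :: ('a \<Rightarrow> 'k) \<Rightarrow> 'v \<Rightarrow> 'k.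
      (\<forall>i. regular_unit I (\<lambda>t. g t i)) \<and>
      (\<forall>t\<in>carrier (torus I). \<forall>\<alpha>\<in>F. g t (head Q \<alpha>) = t \<alpha> * g t (tail Q \<alpha>))"
    if "F \<subseteq> H" for F
    using finite_subset[OF that \<open>finite H\<close>] that
  proof (induction F rule: finite_induct)
    case empty
    show ?case by (intro exI[of _ "\<lambda>t i. 1"]) (simp add: regular_unit_one)
  next
    case (insert \<alpha> F)
    then have \<alpha>: "\<alpha> \<in> H" "\<alpha> \<in> arcs Q" "\<alpha> \<in> I" and F: "F \<subseteq> H" "F \<subseteq> arcs Q" using H by auto
    obtain g :: "('a \<Rightarrow> 'k) \<Rightarrow> 'v \<Rightarrow> 'k" where g: "\<And>i. regular_unit I (\<lambda>t. g t i)"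
      and pot: "\<And>t \<beta>. t \<in> carrier (torus I) \<Longrightarrow> \<beta> \<in> F \<Longrightarrow>
        g t (head Q \<beta>) = t \<beta> * g t (tail Q \<beta>)"
      using insert.IH[OF F(1)] by blast
    let ?F = "Q\<lparr>arcs := F\<rparr>" and ?H = "Q\<lparr>arcs := H\<rparr>"
    interpret F: wf_digraph "doubled ?F"
      using Q F by (intro wf_digraph_doubled wf_digraph_arcs_update)
    interpret H: wf_digraph "doubled ?H"
      using Q H by (intro wf_digraph_doubled wf_digraph_arcs_update)
    \<comment> \<open>The unoriented component of the head of \<open>\<alpha>\<close> before
      \<open>\<alpha>\<close> is added.\<close>
    define S where "S = {v. head Q \<alpha> \<rightarrow>\<^sup>*\<^bsub>doubled ?F\<^esub> v}"
    have head_S: "head Q \<alpha> \<in> S"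
      using \<alpha> Q by (auto simp: S_def wf_digraph.head_in_verts)
    \<comment> \<open>A path in \<open>F\<close> from the head of \<open>\<alpha>\<close> back to
      its tail would be closed by \<open>\<alpha>\<close> to an unoriented cycle in
      \<open>H\<close>. For a loop the path is empty and \<open>\<alpha>\<close> alone is the
      cycle.\<close>
    have tail_S: "tail Q \<alpha> \<notin> S"
    proof
      assume "tail Q \<alpha> \<in> S"
      then obtain p where p: "F.apath (head Q \<alpha>) p (tail Q \<alpha>)"
        by (auto simp: S_def F.reachable_apath)
      have "subgraph (doubled ?F) (doubled ?H)"
        using F.wf_digraph H.wf_digraph F(1)
        by (simp add: subgraph_def compatible_def) (auto simp: doubled_def)
      with p have pH: "H.apath (head Q \<alpha>) p (tail Q \<alpha>)"
        by (rule H.subgraph_apath_imp_apath)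
      have "set p \<subseteq> F \<times> UNIV"
        using F.awalkI_apath[OF p] by (auto simp: F.awalk_def)
      with insert.hyps have "\<alpha> \<notin> fst ` set p" by auto
      moreover have "distinct (map fst p)"
        using p Q F by (intro apath_doubled_distinct[of ?F]) (auto intro: wf_digraph_arcs_update)
      moreover have "H.cycle ((\<alpha>, True) # p)"
        unfolding H.cycle_def
        using pH \<alpha> by (intro exI[of _ "tail Q \<alpha>"]) (auto simp: H.awalk_Cons_iff H.apath_def)
      ultimately have "unoriented_cycle ?H ((\<alpha>, True) # p)"
        by (simp add: unoriented_cycle_def)
      with acyc show False by blast
    qed
    \<comment> \<open>Both ends of an arrow of \<open>F\<close> get rescaled or neither does, so the
      ratios already achieved survive.\<close>
    have closed: "head Q \<beta> \<in> S \<longleftrightarrow> tail Q \<beta> \<in> S" if "\<beta> \<in> F" for \<beta>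
    proof -
      have "tail Q \<beta> \<rightarrow>\<^bsub>doubled ?F\<^esub> head Q \<beta>"
        using that by (intro F.dominatesI[of "(\<beta>, True)"]) (auto simp: arc_to_ends_def)
      moreover have "head Q \<beta> \<rightarrow>\<^bsub>doubled ?F\<^esub> tail Q \<beta>"
        using that by (intro F.dominatesI[of "(\<beta>, False)"]) (auto simp: arc_to_ends_def)
      ultimately show ?thesis
        unfolding S_def by (auto intro: F.reachable_adj_trans)
    qed
    \<comment> \<open>The factor is the solution of the equation \<open>head_\<alpha>\<close> below.
      As a product of units it keeps the new potential a unit.\<close>
    define c where "c t = t \<alpha> * g t (tail Q \<alpha>) * inverse (g t (head Q \<alpha>))" for t
    have c: "regular_unit I c"
      unfolding c_def using \<alpha>(3) g
      by (intro regular_unit_mult regular_unit_inverse regular_unit_coord)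
    have head_\<alpha>: "c t * g t (head Q \<alpha>) = t \<alpha> * g t (tail Q \<alpha>)" if "t \<in> carrier (torus I)" for t
      using g[of "head Q \<alpha>"] that by (simp add: c_def regular_unit_def)
    show ?case
    proof (intro exI[of _ "\<lambda>t i. if i \<in> S then c t * g t i else g t i"] conjI allI ballI)
      fix i
      show "regular_unit I (\<lambda>t. if i \<in> S then c t * g t i else g t i)"
        using g c by (cases "i \<in> S") (simp_all add: regular_unit_mult)
    next
      fix t :: "'a \<Rightarrow> 'k" and \<beta> assume t: "t \<in> carrier (torus I)" and \<beta>: "\<beta> \<in> insert \<alpha> F"
      show "(if head Q \<beta> \<in> S then c t * g t (head Q \<beta>) else g t (head Q \<beta>)) =
        t \<beta> * (if tail Q \<beta> \<in> S then c t * g t (tail Q \<beta>) else g t (tail Q \<beta>))"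
      proof (cases "\<beta> = \<alpha>")
        case True
        then show ?thesis using head_S tail_S head_\<alpha>[OF t] by simp
      next
        case False
        with \<beta> show ?thesis using pot[OF t, of \<beta>] closed[of \<beta>] by simp
      qed
    qed
  qed
  then show ?thesis by blast
qed


section \<open>Supports of stable representations\<close>

lemma dim_field:
  "vector_space.dim (*) (UNIV :: 'k::field set) = 1"
  "vector_space.dim (*) {0 :: 'k} = 0"
proof -
  interpret vector_space "(*) :: 'k \<Rightarrow> 'k \<Rightarrow> 'k"
    by unfold_locales (auto simp: algebra_simps)
  have "span {1} = (UNIV :: 'k set)"
    by (auto simp: span_singleton)
  then show "dim (UNIV :: 'k set) = 1"
    by (intro dim_unique[of "{1}"]) auto
  show "dim {0 :: 'k} = 0"
    by (intro dim_unique[of "{}"]) (auto simp: dependent_def)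
qed

text \<open>
  If no arrow in the support joins \<open>S\<close> to its complement, then \<open>S\<close> and its complement both span
  subrepresentations, and their slopes cannot both be smaller than the average of the two.
\<close>

lemma stable_imp_connected_supp:
  fixes M :: "'a \<Rightarrow> 'k::field"
  assumes Q: "wf_digraph Q" and fin: "finite (verts Q)" and ne: "verts Q \<noteq> {}"
    and \<theta>: "stability_condition Q \<theta>" and st: "stable Q \<theta> M"
  shows "Digraph_Component.connected (Q\<lparr>arcs := supp Q M\<rparr>)"
proof -
  interpret vector_space "(*) :: 'k \<Rightarrow> 'k \<Rightarrow> 'k"
    by unfold_locales (auto simp: algebra_simps)
  have "S = verts Q"
    if S: "S \<subseteq> verts Q" "S \<noteq> {}" and closed: "\<forall>\<alpha>\<in>supp Q M. tail Q \<alpha> \<in> S \<longleftrightarrow> head Q \<alpha> \<in> S" for S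
  proof (rule ccontr)
    assume "S \<noteq> verts Q"
    \<comment> \<open>This is the dimension vector of the subrepresentation that is the whole field
      on \<open>S\<close> and zero elsewhere.\<close>
    define e where "e S = (\<lambda>i\<in>verts Q. if i \<in> S then 1 else 0 :: int)" for S
    define n where "n S = (of_nat (card S) :: rat)" for S :: "'b set"
    have slope: "of_int (\<theta> (e S)) / n S < of_int (\<theta> (\<lambda>i\<in>verts Q. 1)) / n (verts Q)"
      if S: "S \<subset> verts Q" "S \<noteq> {}" and closed: "\<forall>\<alpha>\<in>supp Q M. tail Q \<alpha> \<in> S \<longleftrightarrow> head Q \<alpha> \<in> S" for S
    proof -
      define U :: "'b \<Rightarrow> 'k set" where "U i = (if i \<in> S then UNIV else {0})" for i
      have "subrep Q M U"
        unfolding subrep_def using closed by (auto simp: U_def supp_def)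
      moreover have "\<exists>i\<in>verts Q. U i \<noteq> {0}" "\<exists>i\<in>verts Q. U i \<noteq> UNIV"
        using S by (auto simp: U_def) (use one_neq_zero in blast)+
      ultimately have "slope Q \<theta> (dim_vector Q U) < slope Q \<theta> (\<lambda>i\<in>verts Q. 1)"
        using st by (auto simp: stable_def)
      moreover have "dim_vector Q U = e S"
        by (auto simp: dim_vector_def e_def U_def dim_field)
      moreover have "(\<Sum>i\<in>verts Q. e S i) = int (card S)"
        using S fin by (simp add: e_def sum.If_cases Int_absorb1 psubset_imp_subset)
      ultimately show ?thesis
        by (simp add: slope_def n_def)
    qed
    let ?S' = "verts Q - S"
    have carrier: "e S \<in> carrier (dim_lattice Q)" for S
      by (auto simp: dim_lattice_def e_def)
    have "\<theta> (e S) + \<theta> (e ?S') = \<theta> (e S \<otimes>\<^bsub>dim_lattice Q\<^esub> e ?S')"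
      using hom_mult[OF \<theta>[unfolded stability_condition_def] carrier[of S] carrier[of ?S']] by simp
    also have "e S \<otimes>\<^bsub>dim_lattice Q\<^esub> e ?S' = (\<lambda>i\<in>verts Q. 1)"
      by (auto simp: dim_lattice_def e_def)
    finally have sum: "\<theta> (\<lambda>i\<in>verts Q. 1) = \<theta> (e S) + \<theta> (e ?S')" ..
    have card: "n (verts Q) = n S + n ?S'"
      using S fin by (simp add: n_def card_Diff_subset finite_subset of_nat_diff card_mono)
    have pos: "n S > 0" "n ?S' > 0"
      using S \<open>S \<noteq> verts Q\<close> fin by (auto simp: n_def card_gt_0_iff finite_subset)
    have "of_int (\<theta> (e S)) / n S < of_int (\<theta> (\<lambda>i\<in>verts Q. 1)) / n (verts Q)"
      using S \<open>S \<noteq> verts Q\<close> closed by (intro slope) auto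
    moreover have "of_int (\<theta> (e ?S')) / n ?S' < of_int (\<theta> (\<lambda>i\<in>verts Q. 1)) / n (verts Q)"
      using S \<open>S \<noteq> verts Q\<close> closed Q
      by (intro slope) (auto simp: supp_def wf_digraph_def)
    \<comment> \<open>With a, b the values of \<open>\<theta>\<close> and n, m the sizes of
      \<open>S\<close> and its complement, clearing denominators turns the two inequalities into a m
      < b n and b n < a m.\<close>
    ultimately show False
      using pos unfolding sum card by (simp add: divide_less_eq less_divide_eq field_simps)
  qed
  then show ?thesis
    using Q ne by (subst connected_iff_no_separation) (auto intro: wf_digraph_arcs_update simp: supp_def)
qed

text \<open>Rescaling the arrows by non-zero factors leaves the subrepresentations unchanged, and
  inverting the non-zero entries of \<open>M\<close> carries it to the indicator of its
  support.\<close>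

lemma stable_indicator_supp:
  fixes M :: "'a \<Rightarrow> 'k::field"
  assumes Q: "wf_digraph Q" and M: "M \<in> stable_locus Q \<theta>"
  shows "stable Q \<theta> (indicator_rep Q (supp Q M) :: 'a \<Rightarrow> 'k)"
proof -
  \<comment> \<open>The default 1 off the support only serves to keep \<open>?t\<close> in the
    torus.\<close>
  let ?t = "\<lambda>\<alpha>\<in>arcs Q. if M \<alpha> = 0 then 1 else inverse (M \<alpha>)"
  have "arrow_act Q ?t M \<in> stable_locus Q \<theta>"
    using M by (intro arrow_act_stable[OF Q]) (auto simp: carrier_torus)
  moreover have "arrow_act Q ?t M = indicator_rep Q (supp Q M)"
    by (auto simp: arrow_act_def indicator_rep_def supp_def)
  ultimately show ?thesis
    by (simp add: stable_locus_def)
qed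


section \<open>Fixed points\<close>

text \<open>The polynomial 1 - x + x^2 takes the value 1 at both 0 and 1, so its root avoids them.
  Such a scalar later detects cycles.\<close>

lemma alg_closed_field_ex_not_0_1: "\<exists>c :: 'k::alg_closed_field. c \<noteq> 0 \<and> c \<noteq> 1"
proof -
  obtain c :: 'k where "poly [:1, - 1, 1:] c = 0"
    using alg_closed_imp_poly_has_root[of "[:1, - 1, 1 :: 'k:]"] by auto
  then show ?thesis by (intro exI[of _ c]) auto
qed

text \<open>Fixedness means that every t.M lies in the base change orbit of \<open>M\<close>, and
  two torus elements act equally on \<open>M\<close> exactly if they agree on its support.\<close>

lemma moduli_point_fixed_iff:
  fixes M :: "'a \<Rightarrow> 'k::field"
  assumes Q: "wf_digraph Q" and M: "M \<in> stable_locus Q \<theta>"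
  shows "moduli_point Q \<theta> M \<in> T0_fixed_points Q \<theta> \<longleftrightarrow>
    (\<forall>t\<in>carrier (torus (arcs Q)). \<exists>g\<in>carrier (torus (verts Q)).
       \<forall>\<alpha>\<in>supp Q M. (sigma Q g :: 'a \<Rightarrow> 'k) \<alpha> = t \<alpha>)"
proof -
  have agree: "arrow_act Q t M = arrow_act Q s M \<longleftrightarrow> (\<forall>\<alpha>\<in>supp Q M. s \<alpha> = t \<alpha>)" for s t
    by (auto simp: arrow_act_def supp_def fun_eq_iff)
  \<comment> \<open>The class of \<open>sigma Q g\<close> in \<open>T0 Q\<close> is the unit, which
    acts trivially.\<close>
  have T0_act_sigma: "moduli_point Q \<theta> (arrow_act Q (sigma Q g) M) = moduli_point Q \<theta> M"
    if g: "g \<in> carrier (torus (verts Q))" for g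
  proof -
    have "sigma_image Q #>\<^bsub>torus (arcs Q)\<^esub> sigma Q g = sigma_image Q"
      using g by (intro group.coset_join2 normal_imp_subgroup[OF normal_sigma_image[OF Q]]
          sigma_in_torus[OF Q]) (auto simp: sigma_image_def)
    then have "T0_proj Q (sigma Q g) = \<one>\<^bsub>T0 Q\<^esub>"
      by (simp add: T0_proj_def T0_def)
    moreover have "T0_act Q \<theta> \<one>\<^bsub>T0 Q\<^esub> (moduli_point Q \<theta> M) = moduli_point Q \<theta> M"
      using M by (simp add: moduli_eq[OF Q] flip: group_action.id_eq_one[OF group_action_T0[OF Q]])
    ultimately show ?thesis
      using T0_act_moduli_point[OF Q sigma_in_torus[OF Q g] M] by simp
  qed
  have "moduli_point Q \<theta> M \<in> T0_fixed_points Q \<theta> \<longleftrightarrow>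
      (\<forall>t\<in>carrier (torus (arcs Q)). moduli_point Q \<theta> (arrow_act Q t M) = moduli_point Q \<theta> M)"
    using M by (auto simp: T0_fixed_points_def carrier_T0[OF Q] moduli_eq[OF Q] T0_act_moduli_point[OF Q])
  also have "\<dots> \<longleftrightarrow> (\<forall>t\<in>carrier (torus (arcs Q)). \<exists>g\<in>carrier (torus (verts Q)).
      arrow_act Q t M = arrow_act Q (sigma Q g) M)"
  proof (intro ball_cong refl iffI)
    fix t :: "'a \<Rightarrow> 'k" assume t: "t \<in> carrier (torus (arcs Q))"
    assume eq: "moduli_point Q \<theta> (arrow_act Q t M) = moduli_point Q \<theta> M"
    let ?N = "arrow_act Q t M"
    \<comment> \<open>The identity isomorphism places \<open>?N\<close> in its own orbit.\<close>
    have "?N \<in> {N \<in> rep_space Q. rep_iso Q ?N N}"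
      by (auto simp: rep_space_def arrow_act_def rep_iso_def intro!: exI[of _ "\<lambda>_. 1"])
    then have "?N \<in> moduli_point Q \<theta> M"
      using moduli_point_eq_iso_class[OF Q arrow_act_stable[OF Q t M]] eq by simp
    then show "\<exists>g\<in>carrier (torus (verts Q)). ?N = arrow_act Q (sigma Q g) M"
      by (auto simp: moduli_point_eq_base_orbit[OF Q M] base_act_eq[OF Q])
  qed (auto simp: T0_act_sigma)
  finally show ?thesis by (simp add: agree)
qed

text \<open>Let t be \<open>c\<close> on the first arrow of a cycle and 1 on all others. Then
  \<open>g\<close> is constant along the rest of the cycle, which joins the ends of the first arrow,
  yet the ratio along that arrow should be \<open>c\<close>, which is not 1.\<close>

lemma fixed_imp_no_unoriented_cycle:
  fixes M :: "'a \<Rightarrow> 'k::alg_closed_field"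
  assumes Q: "wf_digraph Q"
    and fixed: "\<And>t :: 'a \<Rightarrow> 'k. t \<in> carrier (torus (arcs Q)) \<Longrightarrow>
      \<exists>g\<in>carrier (torus (verts Q)). \<forall>\<alpha>\<in>H. sigma Q g \<alpha> = t \<alpha>"
    and H: "H \<subseteq> arcs Q"
  shows "\<not> unoriented_cycle (Q\<lparr>arcs := H\<rparr>) p"
proof
  let ?D = "doubled (Q\<lparr>arcs := H\<rparr>)"
  assume cyc: "unoriented_cycle (Q\<lparr>arcs := H\<rparr>) p"
  then obtain u where u: "pre_digraph.awalk ?D u p u" and "p \<noteq> []" and dist: "distinct (map fst p)"
    by (auto simp: unoriented_cycle_def pre_digraph.cycle_def)
  from \<open>p \<noteq> []\<close> obtain \<alpha> b q where p: "p = (\<alpha>, b) # q" by (cases p) auto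
  have arcs: "set p \<subseteq> H \<times> UNIV" and cas: "pre_digraph.cas ?D u p u"
    using u by (auto simp: pre_digraph.awalk_def)
  obtain c :: 'k where c: "c \<noteq> 0" "c \<noteq> 1"
    using alg_closed_field_ex_not_0_1 by blast
  obtain g where g: "g \<in> carrier (torus (verts Q))"
    and "\<forall>\<beta>\<in>H. sigma Q g \<beta> = (\<lambda>\<beta>\<in>arcs Q. if \<beta> = \<alpha> then c else 1) \<beta>"
  proof -
    have "(\<lambda>\<beta>\<in>arcs Q. if \<beta> = \<alpha> then c else 1) \<in> carrier (torus (arcs Q))"
      using c by (auto simp: carrier_torus)
    from fixed[OF this] show thesis using that by blast
  qed
  then have eq: "\<forall>\<beta>\<in>H. sigma Q g \<beta> = (if \<beta> = \<alpha> then c else 1)"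
    using H by auto
  have ratio: "g (head Q \<beta>) = (if \<beta> = \<alpha> then c else 1) * g (tail Q \<beta>)" and nz: "g (tail Q \<beta>) \<noteq> 0"
    if "\<beta> \<in> H" for \<beta>
  proof -
    show nz: "g (tail Q \<beta>) \<noteq> 0"
      using g that H Q by (auto simp: carrier_torus wf_digraph_def)
    show "g (head Q \<beta>) = (if \<beta> = \<alpha> then c else 1) * g (tail Q \<beta>)"
      using eq[rule_format, OF that] that H nz by (auto simp: sigma_def field_simps)
  qed
  have "g (head ?D (\<alpha>, b)) = g u"
  proof (rule cas_doubled_constant[where g = g])
    show "pre_digraph.cas ?D (head ?D (\<alpha>, b)) q u"
      using cas by (simp add: p pre_digraph.cas.simps)
    \<comment> \<open>Distinctness of the arrows keeps \<open>\<alpha>\<close> out of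
      \<open>q\<close>, in either direction, so all prescribed ratios there are 1.\<close>
    show "\<forall>e\<in>set q. g (head (Q\<lparr>arcs := H\<rparr>) (fst e)) = g (tail (Q\<lparr>arcs := H\<rparr>) (fst e))"
      using ratio arcs dist by (force simp: p)
  qed
  moreover have "u = tail ?D (\<alpha>, b)"
    using cas by (simp add: p pre_digraph.cas.simps)
  ultimately have "g (head Q \<alpha>) = g (tail Q \<alpha>)"
    by (simp split: if_splits)
  with ratio[of \<alpha>] nz[of \<alpha>] arcs c show False
    by (auto simp: p)
qed

text \<open>Evaluating the potential of the tree at \<open>t\<close> gives a nowhere vanishing
  function on the vertices, that is, a point of the base change torus.\<close>

lemma tree_sigma_surj:
  fixes t :: "'a \<Rightarrow> 'k::field"
  assumes Q: "fin_digraph Q" and H: "quiver_spanning_tree Q H"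
    and t: "t \<in> carrier (torus (arcs Q))"
  shows "\<exists>g\<in>carrier (torus (verts Q)). \<forall>\<alpha>\<in>H. sigma Q g \<alpha> = t \<alpha>"
proof -
  interpret fin_digraph Q by fact
  have H': "finite H" "H \<subseteq> arcs Q"
    using H by (auto simp: quiver_spanning_tree_def intro: finite_subset)
  obtain g :: "('a \<Rightarrow> 'k) \<Rightarrow> _ \<Rightarrow> 'k" where unit: "\<And>i. regular_unit (arcs Q) (\<lambda>t. g t i)"
    and pot: "\<And>\<alpha>. \<alpha> \<in> H \<Longrightarrow> g t (head Q \<alpha>) = t \<alpha> * g t (tail Q \<alpha>)"
    using forest_potential[OF wf_digraph H' H'(2)] H t unfolding quiver_spanning_tree_def by blast
  have nz: "g t i \<noteq> 0" for i
    using unit[of i] t by (auto simp: regular_unit_def)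
  show ?thesis
    using H' nz pot by (intro bexI[of _ "restrict (g t) (verts Q)"])
      (auto simp: carrier_torus sigma_def)
qed

text \<open>Prescribing the ratios \<open>inverse (M \<alpha>)\<close> on the tree yields a base
  change that normalises every non-zero entry to 1.\<close>

lemma rep_iso_indicator:
  fixes M :: "'a \<Rightarrow> 'k::field"
  assumes Q: "fin_digraph Q" and H: "quiver_spanning_tree Q (supp Q M)"
  shows "rep_iso Q M (indicator_rep Q (supp Q M))"
proof -
  interpret fin_digraph Q by fact
  obtain g where g: "g \<in> carrier (torus (verts Q))"
    and eq: "\<forall>\<alpha>\<in>supp Q M. sigma Q g \<alpha> = inverse (M \<alpha>)"
    using tree_sigma_surj[OF Q H, of "\<lambda>\<alpha>\<in>arcs Q. if M \<alpha> = 0 then 1 else inverse (M \<alpha>)"]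
    by (auto simp: carrier_torus supp_def)
  have nz: "g i \<noteq> 0" if "i \<in> verts Q" for i
    using g that by (auto simp: carrier_torus)
  have "g (head Q \<alpha>) * M \<alpha> = indicator_rep Q (supp Q M) \<alpha> * g (tail Q \<alpha>)" if \<alpha>: "\<alpha> \<in> arcs Q" for \<alpha>
  proof (cases "M \<alpha> = 0")
    case True
    with \<alpha> show ?thesis by (simp add: indicator_rep_def supp_def)
  next
    case False
    with \<alpha> eq have "g (head Q \<alpha>) * inverse (g (tail Q \<alpha>)) = inverse (M \<alpha>)"
      by (auto simp: supp_def sigma_def)
    with \<alpha> False nz[of "tail Q \<alpha>"] show ?thesis
      by (simp add: indicator_rep_def supp_def field_simps)
  qed
  with nz show ?thesis unfolding rep_iso_def by blast
qed

text \<open>Stability of \<open>M\<close> already makes the support connected and its indicator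
  stable, so both sides reduce to the absence of unoriented cycles in the support.\<close>

lemma fixed_iff_stable_spanning_tree:
  fixes M :: "'a \<Rightarrow> 'k::alg_closed_field"
  assumes Q: "fin_digraph Q" and ne: "verts Q \<noteq> {}" and \<theta>: "stability_condition Q \<theta>"
    and M: "M \<in> stable_locus Q \<theta>"
  shows "moduli_point Q \<theta> M \<in> T0_fixed_points Q \<theta> \<longleftrightarrow>
    stable_spanning_tree TYPE('k) Q \<theta> (supp Q M)"
proof -
  interpret fin_digraph Q by fact
  have sub: "supp Q M \<subseteq> arcs Q" by (auto simp: supp_def)
  have "Digraph_Component.connected (Q\<lparr>arcs := supp Q M\<rparr>)"
    using M ne \<theta> by (intro stable_imp_connected_supp[OF wf_digraph]) (auto simp: stable_locus_def)
  then have "stable_spanning_tree TYPE('k) Q \<theta> (supp Q M) \<longleftrightarrow>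
      (\<forall>p. \<not> unoriented_cycle (Q\<lparr>arcs := supp Q M\<rparr>) p)"
      "quiver_spanning_tree Q (supp Q M) \<longleftrightarrow>
      (\<forall>p. \<not> unoriented_cycle (Q\<lparr>arcs := supp Q M\<rparr>) p)"
    using sub stable_indicator_supp[OF wf_digraph M]
    by (auto simp: stable_spanning_tree_def quiver_spanning_tree_def)
  then show ?thesis
    using moduli_point_fixed_iff[OF wf_digraph M]
      fixed_imp_no_unoriented_cycle[OF wf_digraph _ sub] tree_sigma_surj[OF Q]
    by metis
qed


section \<open>The complementary torus of a spanning tree\<close>

lemma T0_proj_eq_iff:
  fixes t u :: "'a \<Rightarrow> 'k::field"
  assumes Q: "wf_digraph Q"
    and t: "t \<in> carrier (torus (arcs Q))" and u: "u \<in> carrier (torus (arcs Q))"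
  shows "T0_proj Q t = T0_proj Q u \<longleftrightarrow>
    (\<exists>g\<in>carrier (torus (verts Q)). \<forall>\<alpha>\<in>arcs Q. t \<alpha> = sigma Q g \<alpha> * u \<alpha>)"
proof -
  interpret T: group "torus (arcs Q) :: ('a \<Rightarrow> 'k) monoid" by simp
  have sub: "subgroup (sigma_image Q) (torus (arcs Q) :: ('a \<Rightarrow> 'k) monoid)"
    by (rule normal_imp_subgroup[OF normal_sigma_image[OF Q]])
  have "T0_proj Q t = T0_proj Q u \<longleftrightarrow> t \<in> T0_proj Q u"
    unfolding T0_proj_def
    using T.repr_independence[OF _ u sub] T.rcos_self[OF t sub] by metis
  also have "\<dots> \<longleftrightarrow> (\<exists>g\<in>carrier (torus (verts Q)). t = (\<lambda>\<alpha>\<in>arcs Q. sigma Q g \<alpha> * u \<alpha>))"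
    by (auto simp: T0_proj_def r_coset_def sigma_image_def mult_torus)
  also have "\<dots> \<longleftrightarrow> (\<exists>g\<in>carrier (torus (verts Q)). \<forall>\<alpha>\<in>arcs Q. t \<alpha> = sigma Q g \<alpha> * u \<alpha>)"
    using t by (intro bex_cong refl) (auto simp: carrier_torus PiE_iff extensional_def fun_eq_iff)
  finally show ?thesis .
qed

lemma subgroup_subtorus: "subgroup (subtorus Q H) (torus (arcs Q) :: ('a \<Rightarrow> 'k::field) monoid)"
proof (rule group.subgroupI[OF group_torus])
  show "subtorus Q H \<noteq> ({} :: ('a \<Rightarrow> 'k) set)"
    by (auto simp: subtorus_def carrier_torus intro!: exI[of _ "\<lambda>\<alpha>\<in>arcs Q. 1"])
  fix t :: "'a \<Rightarrow> 'k" assume t: "t \<in> subtorus Q H"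
  then have "inv\<^bsub>torus (arcs Q)\<^esub> t = (\<lambda>\<alpha>\<in>arcs Q. inverse (t \<alpha>))"
    by (intro group.inv_equality[OF group_torus])
       (auto simp: subtorus_def carrier_torus mult_torus one_torus PiE_iff intro!: restrict_ext)
  with t show "inv\<^bsub>torus (arcs Q)\<^esub> t \<in> subtorus Q H"
    by (auto simp: subtorus_def carrier_torus)
qed (auto simp: subtorus_def carrier_torus mult_torus)

lemma T0_proj_hom:
  "wf_digraph Q \<Longrightarrow> T0_proj Q \<in> hom (torus (arcs Q) :: ('a \<Rightarrow> 'k::field) monoid) (T0 Q)"
  unfolding T0_proj_def T0_def
  by (rule normal.r_coset_hom_Mod[OF normal_sigma_image])

text \<open>Two elements with the same class differ by some \<open>sigma Q g\<close>. Both are 1 on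
  the tree, so \<open>g\<close> is constant along it, hence on all vertices, and
  \<open>sigma Q g\<close> is trivial.\<close>

lemma T0_proj_inj_on_subtorus:
  assumes Q: "wf_digraph Q" and H: "quiver_spanning_tree Q H"
  shows "inj_on (T0_proj Q :: ('a \<Rightarrow> 'k::field) \<Rightarrow> _) (subtorus Q (arcs Q - H))"
proof (rule inj_onI)
  fix t u :: "'a \<Rightarrow> 'k"
  assume t: "t \<in> subtorus Q (arcs Q - H)" and u: "u \<in> subtorus Q (arcs Q - H)"
    and "T0_proj Q t = T0_proj Q u"
  have sub: "H \<subseteq> arcs Q" and conn: "Digraph_Component.connected (Q\<lparr>arcs := H\<rparr>)"
    using H by (auto simp: quiver_spanning_tree_def)
  have tu: "t \<in> carrier (torus (arcs Q))" "u \<in> carrier (torus (arcs Q))"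
    using t u by (auto simp: subtorus_def)
  then obtain g where g: "g \<in> carrier (torus (verts Q))"
    and eq: "\<forall>\<alpha>\<in>arcs Q. t \<alpha> = sigma Q g \<alpha> * u \<alpha>"
    using T0_proj_eq_iff[OF Q] \<open>T0_proj Q t = T0_proj Q u\<close> by blast
  have nz: "g i \<noteq> 0" if "i \<in> verts Q" for i
    using g that by (auto simp: carrier_torus)
  have const: "g (head Q \<alpha>) = g (tail Q \<alpha>)" if "\<alpha> \<in> H" for \<alpha>
  proof -
    have "sigma Q g \<alpha> = 1"
      using eq t u that sub by (auto simp: subtorus_def)
    then show ?thesis
      using that sub nz[OF wf_digraph.tail_in_verts[OF Q, of \<alpha>]] by (auto simp: sigma_def field_simps)
  qed
  have "sigma Q g \<alpha> = 1" if "\<alpha> \<in> arcs Q" for \<alpha>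
  proof -
    \<comment> \<open>Here \<open>\<alpha>\<close> may lie outside \<open>H\<close>; its ends are
      still joined through the tree.\<close>
    have "g (head Q \<alpha>) = g (tail Q \<alpha>)"
      using that const Q
      by - (rule connected_constant[OF wf_digraph_arcs_update[OF Q sub] conn, where g = g],
        auto simp: wf_digraph_def)
    then show ?thesis
      using that nz[OF wf_digraph.tail_in_verts[OF Q, of \<alpha>]] by (simp add: sigma_def)
  qed
  with eq tu show "t = u"
    by (auto simp: carrier_torus PiE_iff extensional_def fun_eq_iff)
qed

text \<open>
  Dividing \<open>t\<close> by \<^const>\<open>sigma\<close> of a potential with ratios \<open>t\<close> on the tree gives a regular retraction of
  the torus onto the subtorus along \<^const>\<open>sigma_image\<close>; it induces the inverse of the projection.
\<close>

lemma tree_retraction: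
  assumes Q: "fin_digraph Q" and H: "quiver_spanning_tree Q H"
  obtains r :: "('a \<Rightarrow> 'k::field) \<Rightarrow> 'a \<Rightarrow> 'k"
  where "\<And>t. t \<in> carrier (torus (arcs Q)) \<Longrightarrow> r t \<in> subtorus Q (arcs Q - H)"
    and "\<And>t. t \<in> carrier (torus (arcs Q)) \<Longrightarrow> T0_proj Q (r t) = T0_proj Q t"
    and "\<And>\<alpha>. \<alpha> \<in> arcs Q \<Longrightarrow> regular_unit (arcs Q) (\<lambda>t. r t \<alpha>)"
proof -
  interpret fin_digraph Q by fact
  have H': "finite H" "H \<subseteq> arcs Q"
    using H by (auto simp: quiver_spanning_tree_def intro: finite_subset)
  obtain g :: "('a \<Rightarrow> 'k) \<Rightarrow> _ \<Rightarrow> 'k" where unit: "\<And>i. regular_unit (arcs Q) (\<lambda>t. g t i)"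
    and pot: "\<And>t \<alpha>. t \<in> carrier (torus (arcs Q)) \<Longrightarrow> \<alpha> \<in> H \<Longrightarrow>
      g t (head Q \<alpha>) = t \<alpha> * g t (tail Q \<alpha>)"
    using forest_potential[OF wf_digraph H' H'(2)] H unfolding quiver_spanning_tree_def by blast
  have nz: "g t i \<noteq> 0" if "t \<in> carrier (torus (arcs Q))" for t i
    using unit[of i] that by (auto simp: regular_unit_def)
  \<comment> \<open>The bracket is \<open>sigma Q\<close> of the pointwise inverse of the potential,
    and it cancels \<open>t\<close> on the tree.\<close>
  define r where "r t = (\<lambda>\<alpha>\<in>arcs Q. t \<alpha> * (inverse (g t (head Q \<alpha>)) * g t (tail Q \<alpha>)))"
    for t :: "'a \<Rightarrow> 'k"
  show thesis
  proof
    fix t :: "'a \<Rightarrow> 'k" assume t: "t \<in> carrier (torus (arcs Q))"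
    have nz_t: "t \<alpha> \<noteq> 0" if "\<alpha> \<in> arcs Q" for \<alpha>
      using t that by (auto simp: carrier_torus)
    have "r t \<alpha> = 1" if "\<alpha> \<in> H" for \<alpha>
      using that H' nz[OF t] nz_t[of \<alpha>] pot[OF t that] by (auto simp: r_def field_simps)
    then show rt: "r t \<in> subtorus Q (arcs Q - H)"
      using nz[OF t] nz_t by (auto simp: subtorus_def carrier_torus) (auto simp: r_def)
    show "T0_proj Q (r t) = T0_proj Q t"
      using rt nz[OF t]
      by (subst T0_proj_eq_iff[OF wf_digraph _ t])
         (auto simp: subtorus_def carrier_torus r_def sigma_def
           intro!: bexI[of _ "\<lambda>i\<in>verts Q. inverse (g t i)"])
  next
    fix \<alpha> assume "\<alpha> \<in> arcs Q"
    then show "regular_unit (arcs Q) (\<lambda>t. r t \<alpha>)"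
      by (simp add: r_def) (intro regular_unit_mult regular_unit_inverse regular_unit_coord unit)
  qed
qed

text \<open>The retraction yields surjectivity and a formula for the inverse, through which
  regularity of the inverse becomes composition with regular units. Regularity of the projection
  itself is built into the functions on the quotient.\<close>

lemma T0_proj_alg_group_iso:
  assumes Q: "fin_digraph Q" and H: "quiver_spanning_tree Q H"
  shows "(T0_proj Q :: ('a \<Rightarrow> 'k::field) \<Rightarrow> ('a \<Rightarrow> 'k) set) \<in>
    alg_group_iso
      ((torus (arcs Q))\<lparr>carrier := subtorus Q (arcs Q - H)\<rparr>)
      (subgroup_functions (subtorus Q (arcs Q - H)) (torus_functions (arcs Q)))
      (T0 Q)
      (T0_functions Q)"
proof -
  interpret fin_digraph Q by fact
  let ?T = "torus (arcs Q) :: ('a \<Rightarrow> 'k) monoid"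
  let ?S = "subtorus Q (arcs Q - H) :: ('a \<Rightarrow> 'k) set"
  let ?TS = "?T\<lparr>carrier := ?S\<rparr>"
  let ?A = "subgroup_functions ?S (torus_functions (arcs Q))"
  obtain r :: "('a \<Rightarrow> 'k) \<Rightarrow> 'a \<Rightarrow> 'k"
    where r: "\<And>t. t \<in> carrier ?T \<Longrightarrow> r t \<in> ?S"
      and proj_r: "\<And>t. t \<in> carrier ?T \<Longrightarrow> T0_proj Q (r t) = T0_proj Q t"
      and unit_r: "\<And>\<alpha>. \<alpha> \<in> arcs Q \<Longrightarrow> regular_unit (arcs Q) (\<lambda>t. r t \<alpha>)"
    using tree_retraction[OF assms] by blast
  have sub: "?S \<subseteq> carrier ?T" by (auto simp: subtorus_def)
  have hom: "T0_proj Q \<in> hom ?TS (T0 Q)"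
    using T0_proj_hom[OF wf_digraph] sub by (simp add: hom_def Pi_iff subset_iff) blast
  have inj: "inj_on (T0_proj Q) ?S"
    by (rule T0_proj_inj_on_subtorus[OF wf_digraph H])
  have "T0_proj Q ` ?S = carrier (T0 Q)"
  proof
    show "T0_proj Q ` ?S \<subseteq> carrier (T0 Q)"
      using sub by (auto simp: carrier_T0[OF wf_digraph])
    show "carrier (T0 Q) \<subseteq> T0_proj Q ` ?S"
      using r proj_r by (auto simp: carrier_T0[OF wf_digraph])
  qed
  with inj have bij: "bij_betw (T0_proj Q) ?S (carrier (T0 Q))"
    by (simp add: bij_betw_def)
  have inv: "inv_into ?S (T0_proj Q) (T0_proj Q t) = r t" if "t \<in> carrier ?T" for t
    using inv_into_f_f[OF inj r[OF that]] proj_r[OF that] by simp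
  have pullback: "(\<lambda>t\<in>?S. f (T0_proj Q t)) \<in> ?A" if "f \<in> T0_functions Q" for f
  proof -
    have "(\<lambda>t\<in>carrier ?T. f (T0_proj Q t)) \<in> torus_functions (arcs Q)"
      using that by (simp add: T0_functions_def quotient_functions_def T0_proj_def)
    moreover have "(\<lambda>t\<in>?S. f (T0_proj Q t)) = restrict (\<lambda>t\<in>carrier ?T. f (T0_proj Q t)) ?S"
      using sub by (auto simp: fun_eq_iff)
    ultimately show ?thesis
      unfolding subgroup_functions_def by blast
  qed
  have pullback_inv: "(\<lambda>C\<in>carrier (T0 Q). f (inv_into ?S (T0_proj Q) C)) \<in> T0_functions Q"
    if "f \<in> ?A" for f
  proof -
    from that obtain h where h: "h \<in> torus_functions (arcs Q)" "f = restrict h ?S"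
      by (auto simp: subgroup_functions_def)
    let ?F = "\<lambda>C\<in>carrier (T0 Q). f (inv_into ?S (T0_proj Q) C)"
    \<comment> \<open>A function on the quotient is regular if its pullback to the torus is, and
      this pullback is \<open>h\<close> composed with the retraction.\<close>
    have "?F (T0_proj Q t) = h (r t)" if "t \<in> carrier ?T" for t
      using that r by (simp add: carrier_T0[OF wf_digraph] inv h(2))
    then have "(\<lambda>t\<in>carrier ?T. ?F (T0_proj Q t)) = (\<lambda>t\<in>carrier ?T. h (r t))"
      by (auto simp: fun_eq_iff)
    moreover have "regular (arcs Q) (\<lambda>t. h (r t))"
      using h(1) r sub unit_r by (intro regular_compose) auto
    ultimately have "(\<lambda>t\<in>carrier ?T. ?F (T0_proj Q t)) \<in> torus_functions (arcs Q)"
      by (simp add: regular_def)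
    then show ?thesis
      unfolding T0_functions_def quotient_functions_def T0_proj_def[symmetric]
      by (simp add: T0_def)
  qed
  have "group ?TS"
    by (rule subgroup.subgroup_is_group[OF subgroup_subtorus group_torus])
  then have "inv_into ?S (T0_proj Q) \<in> iso (T0 Q) ?TS"
    using group.iso_set_sym[of ?TS "T0_proj Q" "T0 Q"] hom bij by (simp add: iso_def)
  then have "inv_into ?S (T0_proj Q) \<in> hom (T0 Q) ?TS"
    by (simp add: iso_def)
  with hom bij pullback pullback_inv show ?thesis
    unfolding alg_group_iso_def alg_group_hom_def by simp
qed

theorem lemma10:
  fixes Q :: "('v, 'a) pre_digraph"
    and \<theta> :: "('v \<Rightarrow> int) \<Rightarrow> int"
  assumes "fin_digraph Q"
    and "Digraph_Component.connected Q"
    and "acyclic_quiver Q"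
    and "stability_condition Q \<theta>"
  shows "(\<forall>M :: 'a \<Rightarrow> 'k::alg_closed_field. M \<in> stable_locus Q \<theta> \<longrightarrow>
            (moduli_point Q \<theta> M \<in> T0_fixed_points Q \<theta> \<longleftrightarrow>
               stable_spanning_tree TYPE('k) Q \<theta> (supp Q M)) \<and>
            (moduli_point Q \<theta> M \<in> T0_fixed_points Q \<theta> \<longrightarrow>
               rep_iso Q M (indicator_rep Q (supp Q M)))) \<and>
         (\<forall>H. quiver_spanning_tree Q H \<longrightarrow>
            (T0_proj Q :: ('a \<Rightarrow> 'k) \<Rightarrow> ('a \<Rightarrow> 'k) set) \<in>
              alg_group_iso
                ((torus (arcs Q))\<lparr>carrier := subtorus Q (arcs Q - H)\<rparr>)
                (subgroup_functions (subtorus Q (arcs Q - H)) (torus_functions (arcs Q)))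
                (T0 Q)
                (T0_functions Q))"
proof -
  \<comment> \<open>Connectedness includes a non-empty vertex set, which passes to the support of
    \<open>M\<close>.\<close>
  have "verts Q \<noteq> {}"
    using assms(2) by (simp add: connected_conv)
  then show ?thesis
    using fixed_iff_stable_spanning_tree[OF assms(1) _ assms(4)] rep_iso_indicator[OF assms(1)]
      T0_proj_alg_group_iso[OF assms(1)]
    by (auto simp: stable_spanning_tree_def)
qed

end
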